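(* Let $(U,\mu)$ be an algebra in a symmetric tensor category $\mathcal{C}$ and let $Q$ be a multiplicative quadratic form on $U$, i.e. $Q\circ\tilde\mu=Q\otimes Q$ on $\Gamma^2(U)\otimes\Gamma^2(U)$. Let $B=Q\circ\rho_U$ be the associated symmetric bilinear form and write $c=c_{U,U}$. Then the following equalities hold: - $Q\otimes B=B\circ\hat\mu\circ(\iota_U\otimes\mathrm{id})$ (right partial linearization); - $B\otimes Q=B\circ\hat\mu\circ(\mathrm{id}\otimes\iota_U)$ (left partial linearization); - $B\otimes B=B\circ\hat\mu\circ\bigl((\mathrm{id}+c)\otimes\mathrm{id}\bigr)=B\circ\hat\mu\circ\bigl(\mathrm{id}\otimes(\mathrm{id}+c)\bigr)$ (full linearization).
   Context: $\mathcal{C}$ is a symmetric tensor category over a field with unit object $\mathbf{1}$ and braiding $c_{U,V}:U\otimes V\to V\otimes U$. For an object $U$, $(\Gamma^2(U),\iota_U)$ is the kernel of $\mathrm{id}-c_{U,U}:U\otimes U\to U\otimes U$, and $\rho_U:U\otimes U\to\Gamma^2(U)$ is the unique morphism with $\iota_U\circ\rho_U=\mathrm{id}+c_{U,U}$. A quadratic form on $U$ is a morphism $Q:\Gamma^2(U)\to\mathbf{1}$. An algebra $(U,\mu)$ is an object with a morphism $\mu:U\otimes U\to U$ (no associativity assumed). The induced multiplication on $U\otimes U$ is $\hat\mu=(\mu\otimes\mu)\circ(\mathrm{id}_U\otimes c_{U,U}\otimes\mathrm{id}_U)$, and $\tilde\mu:\Gamma^2(U)\otimes\Gamma^2(U)\to\Gamma^2(U)$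 is the unique morphism with $\iota_U\circ\tilde\mu=\hat\mu\circ(\iota_U\otimes\iota_U)$. In the formulas, $\mathrm{id}$ without index is the identity of $U\otimes U$. Associativity and unit isomorphisms are suppressed. *)

theory Defs
  imports "HOL-Algebra.Module"
begin

text \<open>
  Raw data of a monoidal category whose hom-sets carry a linear structure over scalars of type
  \<open>'k\<close>. Objects and arrows are carved out of the types \<open>'o\<close> and \<open>'m\<close> by carrier sets. The total
  functions \<open>Comp\<close> and \<open>Plus\<close> are only constrained on composable, respectively parallel, arrows.
  \<open>Comp g f\<close> is \<open>g\<close> after \<open>f\<close>. Associativity and unit isomorphisms are kept explicit.
\<close>

record ('k, 'o, 'm) tensor_data =
  Obj    :: "'o set"
  Arr    :: "'m set"
  Dom    :: "'m \<Rightarrow> 'o"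
  Cod    :: "'m \<Rightarrow> 'o"
  Ident  :: "'o \<Rightarrow> 'm" ("\<i>\<d>\<index>")
  Comp   :: "'m \<Rightarrow> 'm \<Rightarrow> 'm" (infixr "\<cdot>\<index>" 60)
  Zero   :: "'o \<Rightarrow> 'o \<Rightarrow> 'm"
  Plus   :: "'m \<Rightarrow> 'm \<Rightarrow> 'm" (infixl "\<^bold>+\<index>" 65)
  Scale  :: "'k \<Rightarrow> 'm \<Rightarrow> 'm"
  TensO  :: "'o \<Rightarrow> 'o \<Rightarrow> 'o" (infixr "\<otimes>\<^sub>o\<index>" 70)
  TensA  :: "'m \<Rightarrow> 'm \<Rightarrow> 'm" (infixr "\<otimes>\<^sub>a\<index>" 70)
  Unit   :: "'o" ("\<I>\<index>")
  Assoc  :: "'o \<Rightarrow> 'o \<Rightarrow> 'o \<Rightarrow> 'm" ("\<a>\<index>")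
  LUnit  :: "'o \<Rightarrow> 'm" ("\<l>\<index>")
  RUnit  :: "'o \<Rightarrow> 'm" ("\<r>\<index>")
  Braid  :: "'o \<Rightarrow> 'o \<Rightarrow> 'm" ("\<c>\<index>")

context
  fixes C :: "('k, 'o, 'm, 'z) tensor_data_scheme" (structure)
begin

definition hom_set :: "'o \<Rightarrow> 'o \<Rightarrow> 'm set" where
  "hom_set X Y = {f \<in> Arr C. Dom C f = X \<and> Cod C f = Y}"

text \<open>The fields \<open>mult\<close> and \<open>one\<close> are irrelevant for the locale \<open>module\<close>.\<close>

definition hom_module :: "'o \<Rightarrow> 'o \<Rightarrow> ('k, 'm) module" where
  "hom_module X Y =
    \<lparr>carrier = hom_set X Y, monoid.mult = undefined, one = undefined,
     zero = Zero C X Y, add = Plus C, smult = Scale C\<rparr>"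

definition inverse_arrows :: "'m \<Rightarrow> 'm \<Rightarrow> bool" where
  "inverse_arrows f g \<longleftrightarrow>
     f \<in> Arr C \<and> g \<in> hom_set (Cod C f) (Dom C f) \<and>
     g \<cdot> f = \<i>\<d> (Dom C f) \<and> f \<cdot> g = \<i>\<d> (Cod C f)"

definition is_iso :: "'m \<Rightarrow> bool" where
  "is_iso f \<longleftrightarrow> (\<exists>g. inverse_arrows f g)"

definition inv_arr :: "'m \<Rightarrow> 'm" where
  "inv_arr f = (THE g. inverse_arrows f g)"

definition is_mono :: "'m \<Rightarrow> bool" where
  "is_mono f \<longleftrightarrow> f \<in> Arr C \<and>
     (\<forall>X \<in> Obj C. \<forall>g \<in> hom_set X (Dom C f). \<forall>h \<in> hom_set X (Dom C f). f \<cdot> g = f \<cdot> h \<longrightarrow> g = h)"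

definition is_epi :: "'m \<Rightarrow> bool" where
  "is_epi f \<longleftrightarrow> f \<in> Arr C \<and>
     (\<forall>X \<in> Obj C. \<forall>g \<in> hom_set (Cod C f) X. \<forall>h \<in> hom_set (Cod C f) X. g \<cdot> f = h \<cdot> f \<longrightarrow> g = h)"

definition is_kernel :: "'m \<Rightarrow> 'o \<Rightarrow> 'm \<Rightarrow> bool" where
  "is_kernel f N k \<longleftrightarrow>
     f \<in> Arr C \<and> N \<in> Obj C \<and> k \<in> hom_set N (Dom C f) \<and> f \<cdot> k = Zero C N (Cod C f) \<and>
     (\<forall>X \<in> Obj C. \<forall>h \<in> hom_set X (Dom C f).
        f \<cdot> h = Zero C X (Cod C f) \<longrightarrow> (\<exists>!u. u \<in> hom_set X N \<and> k \<cdot> u = h))"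

definition is_cokernel :: "'m \<Rightarrow> 'o \<Rightarrow> 'm \<Rightarrow> bool" where
  "is_cokernel f N p \<longleftrightarrow>
     f \<in> Arr C \<and> N \<in> Obj C \<and> p \<in> hom_set (Cod C f) N \<and> p \<cdot> f = Zero C (Dom C f) N \<and>
     (\<forall>X \<in> Obj C. \<forall>h \<in> hom_set (Cod C f) X.
        h \<cdot> f = Zero C (Dom C f) X \<longrightarrow> (\<exists>!u. u \<in> hom_set N X \<and> u \<cdot> p = h))"

definition is_zero_object :: "'o \<Rightarrow> bool" where
  "is_zero_object N \<longleftrightarrow> N \<in> Obj C \<and>
     (\<forall>X \<in> Obj C. (\<exists>!f. f \<in> hom_set N X) \<and> (\<exists>!f. f \<in> hom_set X N))"

definition is_biproduct :: "'o \<Rightarrow> 'o \<Rightarrow> 'o \<Rightarrow> 'm \<Rightarrow> 'm \<Rightarrow> 'm \<Rightarrow> 'm \<Rightarrow> bool" where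
  "is_biproduct X Y S i j p q \<longleftrightarrow>
     S \<in> Obj C \<and> i \<in> hom_set X S \<and> j \<in> hom_set Y S \<and> p \<in> hom_set S X \<and> q \<in> hom_set S Y \<and>
     p \<cdot> i = \<i>\<d> X \<and> q \<cdot> j = \<i>\<d> Y \<and> (i \<cdot> p) \<^bold>+ (j \<cdot> q) = \<i>\<d> S"

definition is_simple :: "'o \<Rightarrow> bool" where
  "is_simple S \<longleftrightarrow> S \<in> Obj C \<and> \<not> is_zero_object S \<and>
     (\<forall>f. is_mono f \<and> Cod C f = S \<longrightarrow> is_zero_object (Dom C f) \<or> is_iso f)"

text \<open>A filtration \<open>0 = F 0 \<subseteq> F 1 \<subseteq> \<dots> \<subseteq> F n = X\<close> with simple quotients.\<close>

definition finite_length :: "'o \<Rightarrow> bool" where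
  "finite_length X \<longleftrightarrow>
     (\<exists>(n::nat) F. is_zero_object (F 0) \<and> F n = X \<and>
        (\<forall>j<n. \<exists>f S p. f \<in> hom_set (F j) (F (Suc j)) \<and> is_mono f \<and>
                       is_cokernel f S p \<and> is_simple S))"

text \<open>\<open>Y\<close> is a left dual of \<open>X\<close> (equivalently, \<open>X\<close> is a right dual of \<open>Y\<close>).\<close>

definition is_left_dual :: "'o \<Rightarrow> 'o \<Rightarrow> 'm \<Rightarrow> 'm \<Rightarrow> bool" where
  "is_left_dual Y X ev coev \<longleftrightarrow>
     X \<in> Obj C \<and> Y \<in> Obj C \<and>
     ev \<in> hom_set (Y \<otimes>\<^sub>o X) \<I> \<and> coev \<in> hom_set \<I> (X \<otimes>\<^sub>o Y) \<and>
     \<r> X \<cdot> (\<i>\<d> X \<otimes>\<^sub>a ev) \<cdot> \<a> X Y X \<cdot> (coev \<otimes>\<^sub>a \<i>\<d> X) = \<l> X \<and>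
     \<l> Y \<cdot> (ev \<otimes>\<^sub>a \<i>\<d> Y) \<cdot> inv_arr (\<a> Y X Y) \<cdot> (\<i>\<d> Y \<otimes>\<^sub>a coev) = \<r> Y"

end

locale category =
  fixes C :: "('k, 'o, 'm, 'z) tensor_data_scheme" (structure)
  assumes Dom_in_Obj: "f \<in> Arr C \<Longrightarrow> Dom C f \<in> Obj C"
    and Cod_in_Obj: "f \<in> Arr C \<Longrightarrow> Cod C f \<in> Obj C"
    and Ident_in_hom: "X \<in> Obj C \<Longrightarrow> \<i>\<d> X \<in> hom_set C X X"
    and Comp_in_hom: "\<lbrakk>f \<in> hom_set C X Y; g \<in> hom_set C Y Z\<rbrakk> \<Longrightarrow> g \<cdot> f \<in> hom_set C X Z"
    and Comp_assoc:
      "\<lbrakk>f \<in> hom_set C W X; g \<in> hom_set C X Y; h \<in> hom_set C Y Z\<rbrakk> \<Longrightarrow> (h \<cdot> g) \<cdot> f = h \<cdot> (g \<cdot> f)"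
    and Ident_left: "f \<in> hom_set C X Y \<Longrightarrow> \<i>\<d> Y \<cdot> f = f"
    and Ident_right: "f \<in> hom_set C X Y \<Longrightarrow> f \<cdot> \<i>\<d> X = f"

locale linear_category = category C + field K
  for K :: "('k, 'r) ring_scheme" and C :: "('k, 'o, 'm, 'z) tensor_data_scheme" (structure) +
  assumes hom_module: "\<lbrakk>X \<in> Obj C; Y \<in> Obj C\<rbrakk> \<Longrightarrow> module K (hom_module C X Y)"
    and Comp_Plus_left:
      "\<lbrakk>f \<in> hom_set C X Y; g \<in> hom_set C Y Z; h \<in> hom_set C Y Z\<rbrakk>
        \<Longrightarrow> (g \<^bold>+ h) \<cdot> f = (g \<cdot> f) \<^bold>+ (h \<cdot> f)"
    and Comp_Plus_right:
      "\<lbrakk>f \<in> hom_set C X Y; g \<in> hom_set C X Y; h \<in> hom_set C Y Z\<rbrakk>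
        \<Longrightarrow> h \<cdot> (f \<^bold>+ g) = (h \<cdot> f) \<^bold>+ (h \<cdot> g)"
    and Comp_Scale_left:
      "\<lbrakk>a \<in> carrier K; f \<in> hom_set C X Y; g \<in> hom_set C Y Z\<rbrakk>
        \<Longrightarrow> Scale C a g \<cdot> f = Scale C a (g \<cdot> f)"
    and Comp_Scale_right:
      "\<lbrakk>a \<in> carrier K; f \<in> hom_set C X Y; g \<in> hom_set C Y Z\<rbrakk>
        \<Longrightarrow> g \<cdot> Scale C a f = Scale C a (g \<cdot> f)"

locale abelian_linear_category = linear_category +
  assumes ex_zero_object: "\<exists>N. is_zero_object C N"
    and ex_biproduct:
      "\<lbrakk>X \<in> Obj C; Y \<in> Obj C\<rbrakk> \<Longrightarrow> \<exists>S i j p q. is_biproduct C X Y S i j p q"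
    and ex_kernel: "f \<in> Arr C \<Longrightarrow> \<exists>N k. is_kernel C f N k"
    and ex_cokernel: "f \<in> Arr C \<Longrightarrow> \<exists>N p. is_cokernel C f N p"
    and mono_is_kernel: "is_mono C f \<Longrightarrow> \<exists>g. is_kernel C g (Dom C f) f"
    and epi_is_cokernel: "is_epi C f \<Longrightarrow> \<exists>g. is_cokernel C g (Cod C f) f"

locale locally_finite_category = abelian_linear_category +
  assumes hom_finite_dimensional:
      "\<lbrakk>X \<in> Obj C; Y \<in> Obj C\<rbrakk> \<Longrightarrow>
        \<exists>S. finite S \<and> S \<subseteq> hom_set C X Y \<and>
          (\<forall>f \<in> hom_set C X Y. \<exists>a \<in> S \<rightarrow> carrier K.
             f = finsum (hom_module C X Y) (\<lambda>s. Scale C (a s) s) S)"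
    and finite_length: "X \<in> Obj C \<Longrightarrow> finite_length C X"

locale symmetric_monoidal_category = category +
  assumes Unit_in_Obj: "\<I> \<in> Obj C"
    and TensO_in_Obj: "\<lbrakk>X \<in> Obj C; Y \<in> Obj C\<rbrakk> \<Longrightarrow> X \<otimes>\<^sub>o Y \<in> Obj C"
    and TensA_in_hom:
      "\<lbrakk>f \<in> hom_set C X X'; g \<in> hom_set C Y Y'\<rbrakk>
        \<Longrightarrow> f \<otimes>\<^sub>a g \<in> hom_set C (X \<otimes>\<^sub>o Y) (X' \<otimes>\<^sub>o Y')"
    and TensA_Ident: "\<lbrakk>X \<in> Obj C; Y \<in> Obj C\<rbrakk> \<Longrightarrow> \<i>\<d> X \<otimes>\<^sub>a \<i>\<d> Y = \<i>\<d> (X \<otimes>\<^sub>o Y)"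
    and TensA_Comp:
      "\<lbrakk>f \<in> hom_set C X X'; f' \<in> hom_set C X' X''; g \<in> hom_set C Y Y'; g' \<in> hom_set C Y' Y''\<rbrakk>
        \<Longrightarrow> (f' \<cdot> f) \<otimes>\<^sub>a (g' \<cdot> g) = (f' \<otimes>\<^sub>a g') \<cdot> (f \<otimes>\<^sub>a g)"
    and Assoc_in_hom:
      "\<lbrakk>X \<in> Obj C; Y \<in> Obj C; Z \<in> Obj C\<rbrakk>
        \<Longrightarrow> \<a> X Y Z \<in> hom_set C ((X \<otimes>\<^sub>o Y) \<otimes>\<^sub>o Z) (X \<otimes>\<^sub>o (Y \<otimes>\<^sub>o Z))"
    and Assoc_iso: "\<lbrakk>X \<in> Obj C; Y \<in> Obj C; Z \<in> Obj C\<rbrakk> \<Longrightarrow> is_iso C (\<a> X Y Z)"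
    and Assoc_natural:
      "\<lbrakk>f \<in> hom_set C X X'; g \<in> hom_set C Y Y'; h \<in> hom_set C Z Z'\<rbrakk>
        \<Longrightarrow> \<a> X' Y' Z' \<cdot> ((f \<otimes>\<^sub>a g) \<otimes>\<^sub>a h) = (f \<otimes>\<^sub>a (g \<otimes>\<^sub>a h)) \<cdot> \<a> X Y Z"
    and LUnit_in_hom: "X \<in> Obj C \<Longrightarrow> \<l> X \<in> hom_set C (\<I> \<otimes>\<^sub>o X) X"
    and LUnit_iso: "X \<in> Obj C \<Longrightarrow> is_iso C (\<l> X)"
    and LUnit_natural: "f \<in> hom_set C X Y \<Longrightarrow> \<l> Y \<cdot> (\<i>\<d> \<I> \<otimes>\<^sub>a f) = f \<cdot> \<l> X"
    and RUnit_in_hom: "X \<in> Obj C \<Longrightarrow> \<r> X \<in> hom_set C (X \<otimes>\<^sub>o \<I>) X"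
    and RUnit_iso: "X \<in> Obj C \<Longrightarrow> is_iso C (\<r> X)"
    and RUnit_natural: "f \<in> hom_set C X Y \<Longrightarrow> \<r> Y \<cdot> (f \<otimes>\<^sub>a \<i>\<d> \<I>) = f \<cdot> \<r> X"
    and pentagon:
      "\<lbrakk>W \<in> Obj C; X \<in> Obj C; Y \<in> Obj C; Z \<in> Obj C\<rbrakk>
        \<Longrightarrow> (\<i>\<d> W \<otimes>\<^sub>a \<a> X Y Z) \<cdot> \<a> W (X \<otimes>\<^sub>o Y) Z \<cdot> (\<a> W X Y \<otimes>\<^sub>a \<i>\<d> Z)
            = \<a> W X (Y \<otimes>\<^sub>o Z) \<cdot> \<a> (W \<otimes>\<^sub>o X) Y Z"
    and triangle:
      "\<lbrakk>X \<in> Obj C; Y \<in> Obj C\<rbrakk> \<Longrightarrow> (\<i>\<d> X \<otimes>\<^sub>a \<l> Y) \<cdot> \<a> X \<I> Y = \<r> X \<otimes>\<^sub>a \<i>\<d> Y"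
    and Braid_in_hom:
      "\<lbrakk>X \<in> Obj C; Y \<in> Obj C\<rbrakk> \<Longrightarrow> \<c> X Y \<in> hom_set C (X \<otimes>\<^sub>o Y) (Y \<otimes>\<^sub>o X)"
    and Braid_natural:
      "\<lbrakk>f \<in> hom_set C X X'; g \<in> hom_set C Y Y'\<rbrakk>
        \<Longrightarrow> \<c> X' Y' \<cdot> (f \<otimes>\<^sub>a g) = (g \<otimes>\<^sub>a f) \<cdot> \<c> X Y"
    and hexagon:
      "\<lbrakk>X \<in> Obj C; Y \<in> Obj C; Z \<in> Obj C\<rbrakk>
        \<Longrightarrow> \<a> Y Z X \<cdot> \<c> X (Y \<otimes>\<^sub>o Z) \<cdot> \<a> X Y Z
            = (\<i>\<d> Y \<otimes>\<^sub>a \<c> X Z) \<cdot> \<a> Y X Z \<cdot> (\<c> X Y \<otimes>\<^sub>a \<i>\<d> Z)"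
    \<comment> \<open>Makes the braiding invertible; the second hexagon follows from the first one.\<close>
    and Braid_symmetric: "\<lbrakk>X \<in> Obj C; Y \<in> Obj C\<rbrakk> \<Longrightarrow> \<c> Y X \<cdot> \<c> X Y = \<i>\<d> (X \<otimes>\<^sub>o Y)"

text \<open>
  Symmetric tensor categories over a field \<open>K\<close> in the sense of Etingof, Gelaki, Nikshych and
  Ostrik, without the assumption that \<open>K\<close> is algebraically closed.
\<close>

locale symmetric_tensor_category =
  locally_finite_category K C + symmetric_monoidal_category C
  for K :: "('k, 'r) ring_scheme" and C :: "('k, 'o, 'm, 'z) tensor_data_scheme" (structure) +
  assumes TensA_Plus_left:
      "\<lbrakk>f \<in> hom_set C X X'; f' \<in> hom_set C X X'; g \<in> hom_set C Y Y'\<rbrakk>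
        \<Longrightarrow> (f \<^bold>+ f') \<otimes>\<^sub>a g = (f \<otimes>\<^sub>a g) \<^bold>+ (f' \<otimes>\<^sub>a g)"
    and TensA_Plus_right:
      "\<lbrakk>f \<in> hom_set C X X'; g \<in> hom_set C Y Y'; g' \<in> hom_set C Y Y'\<rbrakk>
        \<Longrightarrow> f \<otimes>\<^sub>a (g \<^bold>+ g') = (f \<otimes>\<^sub>a g) \<^bold>+ (f \<otimes>\<^sub>a g')"
    and TensA_Scale_left:
      "\<lbrakk>a \<in> carrier K; f \<in> hom_set C X X'; g \<in> hom_set C Y Y'\<rbrakk>
        \<Longrightarrow> Scale C a f \<otimes>\<^sub>a g = Scale C a (f \<otimes>\<^sub>a g)"
    and TensA_Scale_right:
      "\<lbrakk>a \<in> carrier K; f \<in> hom_set C X X'; g \<in> hom_set C Y Y'\<rbrakk>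
        \<Longrightarrow> f \<otimes>\<^sub>a Scale C a g = Scale C a (f \<otimes>\<^sub>a g)"
    and ex_left_dual: "X \<in> Obj C \<Longrightarrow> \<exists>Y ev coev. is_left_dual C Y X ev coev"
    and ex_right_dual: "X \<in> Obj C \<Longrightarrow> \<exists>Y ev coev. is_left_dual C X Y ev coev"
    and End_Unit: "bij_betw (\<lambda>a. Scale C a (\<i>\<d> \<I>)) (carrier K) (hom_set C \<I> \<I>)"

context
  fixes C :: "('k, 'o, 'm, 'z) tensor_data_scheme" (structure)
begin

text \<open>\<open>(\<Gamma>, \<iota>)\<close> is a kernel of \<open>\<i>\<d> - c\<close> on \<open>U \<otimes> U\<close>, i.e. a choice of \<open>(\<Gamma>\<^sup>2(U), \<iota>\<^sub>U)\<close>.\<close>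

definition is_Gamma2 :: "'o \<Rightarrow> 'o \<Rightarrow> 'm \<Rightarrow> bool" where
  "is_Gamma2 U \<Gamma> \<iota> \<longleftrightarrow>
     U \<in> Obj C \<and>
     is_kernel C (\<i>\<d> (U \<otimes>\<^sub>o U) \<ominus>\<^bsub>hom_module C (U \<otimes>\<^sub>o U) (U \<otimes>\<^sub>o U)\<^esub> \<c> U U) \<Gamma> \<iota>"

definition rho :: "'o \<Rightarrow> 'o \<Rightarrow> 'm \<Rightarrow> 'm" where
  "rho U \<Gamma> \<iota> = (THE r. r \<in> hom_set C (U \<otimes>\<^sub>o U) \<Gamma> \<and> \<iota> \<cdot> r = \<i>\<d> (U \<otimes>\<^sub>o U) \<^bold>+ \<c> U U)"

definition is_quadratic_form :: "'o \<Rightarrow> 'm \<Rightarrow> bool" where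
  "is_quadratic_form \<Gamma> Q \<longleftrightarrow> Q \<in> hom_set C \<Gamma> \<I>"

definition bilinear_form_of :: "'o \<Rightarrow> 'o \<Rightarrow> 'm \<Rightarrow> 'm \<Rightarrow> 'm" where
  "bilinear_form_of U \<Gamma> \<iota> Q = Q \<cdot> rho U \<Gamma> \<iota>"

definition is_algebra_object :: "'o \<Rightarrow> 'm \<Rightarrow> bool" where
  "is_algebra_object U \<mu> \<longleftrightarrow> U \<in> Obj C \<and> \<mu> \<in> hom_set C (U \<otimes>\<^sub>o U) U"

text \<open>\<open>\<i>\<d> \<otimes> c \<otimes> \<i>\<d>\<close> on \<open>(U \<otimes> U) \<otimes> (U \<otimes> U)\<close>, with the associativity isomorphisms inserted.\<close>

definition middle_braid :: "'o \<Rightarrow> 'm" where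
  "middle_braid U =
     inv_arr C (\<a> U U (U \<otimes>\<^sub>o U)) \<cdot>
     (\<i>\<d> U \<otimes>\<^sub>a (\<a> U U U \<cdot> (\<c> U U \<otimes>\<^sub>a \<i>\<d> U) \<cdot> inv_arr C (\<a> U U U))) \<cdot>
     \<a> U U (U \<otimes>\<^sub>o U)"

definition mu_hat :: "'o \<Rightarrow> 'm \<Rightarrow> 'm" where
  "mu_hat U \<mu> = (\<mu> \<otimes>\<^sub>a \<mu>) \<cdot> middle_braid U"

definition mu_tilde :: "'o \<Rightarrow> 'm \<Rightarrow> 'o \<Rightarrow> 'm \<Rightarrow> 'm" where
  "mu_tilde U \<mu> \<Gamma> \<iota> =
     (THE t. t \<in> hom_set C (\<Gamma> \<otimes>\<^sub>o \<Gamma>) \<Gamma> \<and> \<iota> \<cdot> t = mu_hat U \<mu> \<cdot> (\<iota> \<otimes>\<^sub>a \<iota>))"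

text \<open>
  The product \<open>X \<otimes> Y \<rightarrow> \<one>\<close> of two forms \<open>X \<rightarrow> \<one>\<close> and \<open>Y \<rightarrow> \<one>\<close>, using the canonical
  isomorphism \<open>\<one> \<otimes> \<one> \<cong> \<one>\<close> (for which the left and right unit isomorphisms agree).
\<close>

definition form_tensor :: "'m \<Rightarrow> 'm \<Rightarrow> 'm" where
  "form_tensor p q = \<l> \<I> \<cdot> (p \<otimes>\<^sub>a q)"

definition is_multiplicative :: "'o \<Rightarrow> 'm \<Rightarrow> 'o \<Rightarrow> 'm \<Rightarrow> 'm \<Rightarrow> bool" where
  "is_multiplicative U \<mu> \<Gamma> \<iota> Q \<longleftrightarrow> Q \<cdot> mu_tilde U \<mu> \<Gamma> \<iota> = form_tensor Q Q"

end

end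

theory Submission
  imports Defs
begin

text \<open>
  Since the braiding is natural and symmetric, the flip \<open>c\<close> of \<open>U \<otimes> U\<close> is an automorphism of the
  algebra \<open>(U \<otimes> U, mu_hat)\<close>. As \<open>\<iota>\<close> is the inclusion of the \<open>c\<close>-invariants and \<open>\<iota> \<rho> = \<i>\<d> + c\<close>,
  composing with the monomorphism \<open>\<iota>\<close> shows \<open>mu_tilde (\<i>\<d> \<otimes> \<rho>) = \<rho> mu_hat (\<iota> \<otimes> \<i>\<d>)\<close>, and symmetrically on
  the other side. Applying \<open>Q\<close> and multiplicativity gives the partial linearizations; composing
  these with \<open>\<rho> \<otimes> \<i>\<d>\<close> and \<open>\<i>\<d> \<otimes> \<rho>\<close> gives the full one.
\<close>

section \<open>Arrows, composition and inverses with explicit domains and codomains\<close>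

context category
begin

text \<open>The locale axioms mention intermediate objects that a rewrite rule cannot guess.
  Unfolding hom-set membership into equations on \<open>Dom\<close> and \<open>Cod\<close> lets the
  simplifier discharge all typing conditions by computation.\<close>

lemma in_hom_set_iff: "f \<in> hom_set C X Y \<longleftrightarrow> f \<in> Arr C \<and> Dom C f = X \<and> Cod C f = Y"
  by (simp add: hom_set_def)

lemma Ident_arr [simp]:
  assumes "X \<in> Obj C"
  shows "\<i>\<d> X \<in> Arr C" "Dom C (\<i>\<d> X) = X" "Cod C (\<i>\<d> X) = X"
  using Ident_in_hom[OF assms] by (simp_all add: in_hom_set_iff)

lemma Comp_arr [simp]:
  assumes "f \<in> Arr C" "g \<in> Arr C" "Cod C f = Dom C g"
  shows "g \<cdot> f \<in> Arr C" "Dom C (g \<cdot> f) = Dom C f" "Cod C (g \<cdot> f) = Cod C g"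
  using Comp_in_hom[of f "Dom C f" "Cod C f" g "Cod C g"] assms by (simp_all add: in_hom_set_iff)

lemma Comp_assoc_arr [simp]:
  assumes "f \<in> Arr C" "g \<in> Arr C" "h \<in> Arr C" "Cod C f = Dom C g" "Cod C g = Dom C h"
  shows "(h \<cdot> g) \<cdot> f = h \<cdot> g \<cdot> f"
  by (rule Comp_assoc[of f "Dom C f" "Cod C f" g "Cod C g" h "Cod C h"])
     (use assms in \<open>simp_all add: in_hom_set_iff\<close>)

lemma Comp_Ident_arr [simp]:
  assumes "f \<in> Arr C"
  shows "Cod C f = X \<Longrightarrow> \<i>\<d> X \<cdot> f = f" "Dom C f = X \<Longrightarrow> f \<cdot> \<i>\<d> X = f"
  using Ident_left[of f "Dom C f" "Cod C f"] Ident_right[of f "Dom C f" "Cod C f"] assms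
  by (auto simp: in_hom_set_iff)

text \<open>Evaluate \<open>h \<cdot> f \<cdot> g\<close> in two ways. This makes the definite
  description in \<open>inv_arr\<close> meaningful.\<close>

lemma inverse_arrows_unique:
  assumes "inverse_arrows C f g" "inverse_arrows C f h"
  shows "g = h"
proof -
  have *: "f \<in> Arr C" "g \<in> Arr C" "h \<in> Arr C" "Dom C g = Cod C f" "Cod C g = Dom C f"
    "Dom C h = Cod C f" "Cod C h = Dom C f" "h \<cdot> f = \<i>\<d> (Dom C f)" "f \<cdot> g = \<i>\<d> (Cod C f)"
    using assms by (auto simp: inverse_arrows_def in_hom_set_iff)
  then have "(h \<cdot> f) \<cdot> g = h \<cdot> f \<cdot> g"
    by (intro Comp_assoc_arr) auto
  with * show ?thesis by simp
qed

lemma inv_arr_inverse: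
  assumes "is_iso C f"
  shows "inverse_arrows C f (inv_arr C f)"
  unfolding inv_arr_def
  by (rule theI') (use assms inverse_arrows_unique in \<open>auto simp: is_iso_def\<close>)

lemma inv_arr_props:
  assumes "is_iso C f"
  shows "inv_arr C f \<in> Arr C" "Dom C (inv_arr C f) = Cod C f" "Cod C (inv_arr C f) = Dom C f"
    "inv_arr C f \<cdot> f = \<i>\<d> (Dom C f)" "f \<cdot> inv_arr C f = \<i>\<d> (Cod C f)"
  using inv_arr_inverse[OF assms] by (auto simp: inverse_arrows_def in_hom_set_iff)

text \<open>Composites are normalised to right-nested form, where the product
  \<open>x \<cdot> y\<close> is no subterm of \<open>x \<cdot> y \<cdot> w\<close>; this carries an
  equation for the product over to that form.\<close>

lemma Comp_cancel_right:
  assumes "x \<cdot> y = z" "x \<in> Arr C" "y \<in> Arr C" "w \<in> Arr C" "Cod C y = Dom C x" "Cod C w = Dom C y"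
  shows "x \<cdot> y \<cdot> w = z \<cdot> w"
  using Comp_assoc_arr[of w y x] assms by simp

end

section \<open>The hexagons and the braiding of \<open>U \<otimes> U\<close> with itself\<close>

context symmetric_monoidal_category
begin

lemmas [simp] = Unit_in_Obj TensO_in_Obj

lemma TensA_arr [simp]:
  assumes "f \<in> Arr C" "g \<in> Arr C"
  shows "f \<otimes>\<^sub>a g \<in> Arr C" "Dom C (f \<otimes>\<^sub>a g) = Dom C f \<otimes>\<^sub>o Dom C g"
    "Cod C (f \<otimes>\<^sub>a g) = Cod C f \<otimes>\<^sub>o Cod C g"
  using TensA_in_hom[of f "Dom C f" "Cod C f" g "Dom C g" "Cod C g"] assms
  by (simp_all add: in_hom_set_iff)

text \<open>The interchange law, oriented to merge two tensor products into one. It is no default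
  rewrite rule, so merging happens only where requested.\<close>

lemma TensA_Comp_arr:
  assumes "f \<in> Arr C" "f' \<in> Arr C" "Cod C f = Dom C f'" "g \<in> Arr C" "g' \<in> Arr C" "Cod C g = Dom C g'"
  shows "(f' \<otimes>\<^sub>a g') \<cdot> (f \<otimes>\<^sub>a g) = (f' \<cdot> f) \<otimes>\<^sub>a (g' \<cdot> g)"
  by (rule TensA_Comp[symmetric]) (use assms in \<open>auto simp: in_hom_set_iff\<close>)

lemma Assoc_arr [simp]:
  assumes "X \<in> Obj C" "Y \<in> Obj C" "Z \<in> Obj C"
  shows "\<a> X Y Z \<in> Arr C" "Dom C (\<a> X Y Z) = (X \<otimes>\<^sub>o Y) \<otimes>\<^sub>o Z" "Cod C (\<a> X Y Z) = X \<otimes>\<^sub>o Y \<otimes>\<^sub>o Z"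
  using Assoc_in_hom[OF assms] by (simp_all add: in_hom_set_iff)

lemma Assoc_inv [simp]:
  assumes "X \<in> Obj C" "Y \<in> Obj C" "Z \<in> Obj C"
  shows "inv_arr C (\<a> X Y Z) \<in> Arr C" "Dom C (inv_arr C (\<a> X Y Z)) = X \<otimes>\<^sub>o Y \<otimes>\<^sub>o Z"
    "Cod C (inv_arr C (\<a> X Y Z)) = (X \<otimes>\<^sub>o Y) \<otimes>\<^sub>o Z"
    "inv_arr C (\<a> X Y Z) \<cdot> \<a> X Y Z = \<i>\<d> ((X \<otimes>\<^sub>o Y) \<otimes>\<^sub>o Z)"
    "\<a> X Y Z \<cdot> inv_arr C (\<a> X Y Z) = \<i>\<d> (X \<otimes>\<^sub>o Y \<otimes>\<^sub>o Z)"
  using inv_arr_props[OF Assoc_iso[OF assms]] assms by simp_all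

lemma Assoc_inv_Comp [simp]:
  assumes "X \<in> Obj C" "Y \<in> Obj C" "Z \<in> Obj C" "f \<in> Arr C"
  shows "Cod C f = (X \<otimes>\<^sub>o Y) \<otimes>\<^sub>o Z \<Longrightarrow> inv_arr C (\<a> X Y Z) \<cdot> \<a> X Y Z \<cdot> f = f"
    "Cod C f = X \<otimes>\<^sub>o Y \<otimes>\<^sub>o Z \<Longrightarrow> \<a> X Y Z \<cdot> inv_arr C (\<a> X Y Z) \<cdot> f = f"
  using assms by (simp_all add: Comp_cancel_right[OF Assoc_inv(4)] Comp_cancel_right[OF Assoc_inv(5)])

lemma Braid_arr [simp]:
  assumes "X \<in> Obj C" "Y \<in> Obj C"
  shows "\<c> X Y \<in> Arr C" "Dom C (\<c> X Y) = X \<otimes>\<^sub>o Y" "Cod C (\<c> X Y) = Y \<otimes>\<^sub>o X"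
  using Braid_in_hom[OF assms] by (simp_all add: in_hom_set_iff)

lemmas [simp] = Braid_symmetric TensA_Ident

lemma Braid_symmetric_Comp [simp]:
  assumes "X \<in> Obj C" "Y \<in> Obj C" "f \<in> Arr C" "Cod C f = X \<otimes>\<^sub>o Y"
  shows "\<c> Y X \<cdot> \<c> X Y \<cdot> f = f"
  using assms by (simp add: Comp_cancel_right[OF Braid_symmetric])

lemma Assoc_natural_arr:
  assumes "f \<in> Arr C" "g \<in> Arr C" "h \<in> Arr C"
  shows "\<a> (Cod C f) (Cod C g) (Cod C h) \<cdot> ((f \<otimes>\<^sub>a g) \<otimes>\<^sub>a h)
    = (f \<otimes>\<^sub>a (g \<otimes>\<^sub>a h)) \<cdot> \<a> (Dom C f) (Dom C g) (Dom C h)"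
  by (rule Assoc_natural) (use assms in \<open>auto simp: in_hom_set_iff\<close>)

text \<open>The hexagon composed with an inverse associator, so that it rewrites the braiding past a
  product directly.\<close>

lemma Braid_TensO_right:
  assumes "X \<in> Obj C" "Y \<in> Obj C" "Z \<in> Obj C"
  shows "\<a> Y Z X \<cdot> \<c> X (Y \<otimes>\<^sub>o Z)
    = (\<i>\<d> Y \<otimes>\<^sub>a \<c> X Z) \<cdot> \<a> Y X Z \<cdot> (\<c> X Y \<otimes>\<^sub>a \<i>\<d> Z) \<cdot> inv_arr C (\<a> X Y Z)"
proof -
  have "(\<a> Y Z X \<cdot> \<c> X (Y \<otimes>\<^sub>o Z) \<cdot> \<a> X Y Z) \<cdot> inv_arr C (\<a> X Y Z)
    = ((\<i>\<d> Y \<otimes>\<^sub>a \<c> X Z) \<cdot> \<a> Y X Z \<cdot> (\<c> X Y \<otimes>\<^sub>a \<i>\<d> Z)) \<cdot> inv_arr C (\<a> X Y Z)"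
    using hexagon[OF assms] by simp
  then show ?thesis using assms by simp
qed

text \<open>The second hexagon, obtained by inverting the first one with the help of symmetry.\<close>

lemma Braid_TensO_left:
  assumes "X \<in> Obj C" "Y \<in> Obj C" "Z \<in> Obj C"
  shows "\<c> (X \<otimes>\<^sub>o Y) Z
    = \<a> Z X Y \<cdot> (\<c> X Z \<otimes>\<^sub>a \<i>\<d> Y) \<cdot> inv_arr C (\<a> X Z Y) \<cdot> (\<i>\<d> X \<otimes>\<^sub>a \<c> Y Z) \<cdot> \<a> X Y Z"
    (is "_ = ?g")
proof -
  have sym1: "(\<c> Z X \<otimes>\<^sub>a \<i>\<d> Y) \<cdot> (\<c> X Z \<otimes>\<^sub>a \<i>\<d> Y) \<cdot> f = f"
    if "f \<in> Arr C" "Cod C f = (X \<otimes>\<^sub>o Z) \<otimes>\<^sub>o Y" for f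
  proof -
    have "(\<c> Z X \<otimes>\<^sub>a \<i>\<d> Y) \<cdot> (\<c> X Z \<otimes>\<^sub>a \<i>\<d> Y) = \<i>\<d> ((X \<otimes>\<^sub>o Z) \<otimes>\<^sub>o Y)"
      using assms by (simp add: TensA_Comp_arr)
    from Comp_cancel_right[OF this, of f] show ?thesis using that assms by simp
  qed
  have sym2: "(\<i>\<d> X \<otimes>\<^sub>a \<c> Z Y) \<cdot> (\<i>\<d> X \<otimes>\<^sub>a \<c> Y Z) \<cdot> f = f"
    if "f \<in> Arr C" "Cod C f = X \<otimes>\<^sub>o Y \<otimes>\<^sub>o Z" for f
  proof -
    have "(\<i>\<d> X \<otimes>\<^sub>a \<c> Z Y) \<cdot> (\<i>\<d> X \<otimes>\<^sub>a \<c> Y Z) = \<i>\<d> (X \<otimes>\<^sub>o Y \<otimes>\<^sub>o Z)"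
      using assms by (simp add: TensA_Comp_arr)
    from Comp_cancel_right[OF this, of f] show ?thesis using that assms by simp
  qed
  \<comment> \<open>Apart from its last associator, \<open>?g\<close> is the inverse, factor by
    factor, of the first hexagon for \<open>Z\<close> past \<open>X \<otimes> Y\<close>. Everything
    therefore telescopes to \<open>\<a> X Y Z\<close>, so \<open>?g\<close> is a right inverse of
    \<open>\<c> Z (X \<otimes> Y)\<close>, which symmetry identifies with the opposite
    braiding.\<close>
  have "\<a> X Y Z \<cdot> \<c> Z (X \<otimes>\<^sub>o Y) \<cdot> ?g = (\<a> X Y Z \<cdot> \<c> Z (X \<otimes>\<^sub>o Y)) \<cdot> ?g"
    using assms by simp
  also have "\<dots> = \<a> X Y Z"
    using assms by (simp add: Braid_TensO_right sym1 sym2)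
  finally have "inv_arr C (\<a> X Y Z) \<cdot> \<a> X Y Z \<cdot> \<c> Z (X \<otimes>\<^sub>o Y) \<cdot> ?g = inv_arr C (\<a> X Y Z) \<cdot> \<a> X Y Z"
    by simp
  then have "\<c> Z (X \<otimes>\<^sub>o Y) \<cdot> ?g = \<i>\<d> ((X \<otimes>\<^sub>o Y) \<otimes>\<^sub>o Z)"
    using assms by simp
  then have "\<c> (X \<otimes>\<^sub>o Y) Z \<cdot> \<c> Z (X \<otimes>\<^sub>o Y) \<cdot> ?g = \<c> (X \<otimes>\<^sub>o Y) Z"
    using assms by simp
  then show ?thesis using assms by simp
qed

text \<open>
  After rebracketing by \<open>\<alpha> : (U \<otimes> U) \<otimes> (U \<otimes> U) \<rightarrow> U \<otimes> (U \<otimes> (U \<otimes> U))\<close>, write \<open>s1\<close>, \<open>s2\<close>, \<open>s3\<close> for the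
  adjacent transpositions. Then \<open>middle_braid\<close> is \<open>s2\<close>, \<open>c \<otimes> c\<close> is \<open>s1 s3\<close> and the braiding of \<open>U \<otimes> U\<close>
  with itself is \<open>s2 s1 s3 s2\<close>, so that the claim reduces to \<open>s2\<^sup>2 = \<i>\<d>\<close>.
\<close>

lemma Braid_middle_braid:
  assumes U [simp]: "U \<in> Obj C"
  shows "\<c> (U \<otimes>\<^sub>o U) (U \<otimes>\<^sub>o U) \<cdot> middle_braid C U = middle_braid C U \<cdot> (\<c> U U \<otimes>\<^sub>a \<c> U U)"
proof -
  define V where "V = U \<otimes>\<^sub>o U"
  define \<alpha> where "\<alpha> = \<a> U U V"
  define \<alpha>' where "\<alpha>' = inv_arr C \<alpha>"
  define A where "A = \<a> U U U"
  define A' where "A' = inv_arr C A"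
  define s1 where "s1 = \<alpha> \<cdot> (\<c> U U \<otimes>\<^sub>a \<i>\<d> V) \<cdot> \<alpha>'"
  define s2 where "s2 = \<i>\<d> U \<otimes>\<^sub>a (A \<cdot> (\<c> U U \<otimes>\<^sub>a \<i>\<d> U) \<cdot> A')"
  define s3 where "s3 = \<i>\<d> U \<otimes>\<^sub>a (\<i>\<d> U \<otimes>\<^sub>a \<c> U U)"
  \<comment> \<open>The pentagon for four copies of \<open>U\<close> reads
    \<open>D \<cdot> (A \<otimes> \<i>\<d>) = \<alpha> \<cdot> \<beta>\<close>: \<open>D\<close> and
    \<open>\<beta>\<close> belong to its two different paths.\<close>
  define D where "D = (\<i>\<d> U \<otimes>\<^sub>a A) \<cdot> \<a> U V U"
  define \<beta> where "\<beta> = \<a> V U U"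
  define W where "W = U \<otimes>\<^sub>o U \<otimes>\<^sub>o V"
  \<comment> \<open>Tensor powers are folded into the names \<open>V\<close> and \<open>W\<close>;
    the typing and inverse laws are then restated in this folded form for the simplifier.\<close>
  have V [simp]: "V \<in> Obj C" "U \<otimes>\<^sub>o U = V" by (simp_all add: V_def)
  have c [simp]: "\<c> U U \<in> Arr C" "Dom C (\<c> U U) = V" "Cod C (\<c> U U) = V"
    using Braid_arr[of U U] by simp_all
  have cc [simp]: "\<c> U U \<cdot> \<c> U U = \<i>\<d> V" "\<And>f. f \<in> Arr C \<Longrightarrow> Cod C f = V \<Longrightarrow> \<c> U U \<cdot> \<c> U U \<cdot> f = f"
    using Braid_symmetric[of U U] Braid_symmetric_Comp[of U U] by simp_all
  have \<alpha> [simp]: "\<alpha> \<in> Arr C" "Dom C \<alpha> = V \<otimes>\<^sub>o V" "Cod C \<alpha> = W"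
    using Assoc_arr[of U U V] by (simp_all add: \<alpha>_def W_def)
  have \<alpha>' [simp]: "\<alpha>' \<in> Arr C" "Dom C \<alpha>' = W" "Cod C \<alpha>' = V \<otimes>\<^sub>o V"
    "\<alpha>' \<cdot> \<alpha> = \<i>\<d> (V \<otimes>\<^sub>o V)" "\<alpha> \<cdot> \<alpha>' = \<i>\<d> W"
    "\<And>f. f \<in> Arr C \<Longrightarrow> Cod C f = V \<otimes>\<^sub>o V \<Longrightarrow> \<alpha>' \<cdot> \<alpha> \<cdot> f = f"
    "\<And>f. f \<in> Arr C \<Longrightarrow> Cod C f = W \<Longrightarrow> \<alpha> \<cdot> \<alpha>' \<cdot> f = f"
    using Assoc_inv[of U U V] Assoc_inv_Comp[of U U V] by (simp_all add: \<alpha>'_def \<alpha>_def W_def)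
  have A [simp]: "A \<in> Arr C" "Dom C A = V \<otimes>\<^sub>o U" "Cod C A = U \<otimes>\<^sub>o V"
    using Assoc_arr[of U U U] by (simp_all add: A_def)
  have A' [simp]: "A' \<in> Arr C" "Dom C A' = U \<otimes>\<^sub>o V" "Cod C A' = V \<otimes>\<^sub>o U"
    "A' \<cdot> A = \<i>\<d> (V \<otimes>\<^sub>o U)" "A \<cdot> A' = \<i>\<d> (U \<otimes>\<^sub>o V)"
    "\<And>f. f \<in> Arr C \<Longrightarrow> Cod C f = V \<otimes>\<^sub>o U \<Longrightarrow> A' \<cdot> A \<cdot> f = f"
    using Assoc_inv[of U U U] Assoc_inv_Comp[of U U U] by (simp_all add: A'_def A_def)
  have W [simp]: "W \<in> Obj C" "U \<otimes>\<^sub>o U \<otimes>\<^sub>o V = W" by (simp_all add: W_def)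
  have s [simp]: "s1 \<in> Arr C" "Dom C s1 = W" "Cod C s1 = W"
    "s2 \<in> Arr C" "Dom C s2 = W" "Cod C s2 = W" "s3 \<in> Arr C" "Dom C s3 = W" "Cod C s3 = W"
    by (simp_all add: s1_def s2_def s3_def)
  have \<beta> [simp]: "\<beta> \<in> Arr C" "Dom C \<beta> = (V \<otimes>\<^sub>o U) \<otimes>\<^sub>o U" "Cod C \<beta> = V \<otimes>\<^sub>o V"
    using Assoc_arr[of V U U] by (simp_all add: \<beta>_def)
  have \<beta>' [simp]: "inv_arr C \<beta> \<in> Arr C" "Dom C (inv_arr C \<beta>) = V \<otimes>\<^sub>o V"
    "Cod C (inv_arr C \<beta>) = (V \<otimes>\<^sub>o U) \<otimes>\<^sub>o U" "\<beta> \<cdot> inv_arr C \<beta> = \<i>\<d> (V \<otimes>\<^sub>o V)"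
    using Assoc_inv[of V U U] by (simp_all add: \<beta>_def)
  have D [simp]: "D \<in> Arr C" "Dom C D = (U \<otimes>\<^sub>o V) \<otimes>\<^sub>o U" "Cod C D = W"
    by (simp_all add: D_def)
  have M: "middle_braid C U = \<alpha>' \<cdot> s2 \<cdot> \<alpha>"
    by (simp add: middle_braid_def \<alpha>'_def s2_def \<alpha>_def A_def A'_def)
  have s2s2: "s2 \<cdot> s2 = \<i>\<d> W"
  proof -
    have "(\<c> U U \<otimes>\<^sub>a \<i>\<d> U) \<cdot> (\<c> U U \<otimes>\<^sub>a \<i>\<d> U) = \<i>\<d> (V \<otimes>\<^sub>o U)"
      by (simp add: TensA_Comp_arr)
    from Comp_cancel_right[OF this, of A'] show ?thesis
      by (simp add: s2_def TensA_Comp_arr)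
  qed
  have s1: "s1 \<cdot> \<alpha> = \<alpha> \<cdot> (\<c> U U \<otimes>\<^sub>a \<i>\<d> V)"
    by (simp add: s1_def)
  have s3: "s3 \<cdot> \<alpha> = \<alpha> \<cdot> (\<i>\<d> V \<otimes>\<^sub>a \<c> U U)"
    using Assoc_natural_arr[of "\<i>\<d> U" "\<i>\<d> U" "\<c> U U"] by (simp add: s3_def \<alpha>_def)
  have pent: "D \<cdot> (A \<otimes>\<^sub>a \<i>\<d> U) = \<alpha> \<cdot> \<beta>"
    using pentagon[of U U U U] by (simp add: D_def \<alpha>_def \<beta>_def A_def)
  have cVU: "\<c> V U = A \<cdot> (\<c> U U \<otimes>\<^sub>a \<i>\<d> U) \<cdot> A' \<cdot> (\<i>\<d> U \<otimes>\<^sub>a \<c> U U) \<cdot> A"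
    using Braid_TensO_left[of U U U] by (simp add: A_def A'_def)
  \<comment> \<open>By the second hexagon (\<open>cVU\<close>), moving the block \<open>V\<close>
    past one \<open>U\<close> is a product of two adjacent transpositions. \<open>r1\<close> does
    this on the last three factors, \<open>r2\<close> on the first three.\<close>
  have r1: "(\<i>\<d> U \<otimes>\<^sub>a \<c> V U) \<cdot> \<a> U V U = s2 \<cdot> s3 \<cdot> D"
  proof -
    have "s2 \<cdot> s3 \<cdot> (\<i>\<d> U \<otimes>\<^sub>a A) = \<i>\<d> U \<otimes>\<^sub>a \<c> V U"
      by (simp add: s2_def s3_def cVU TensA_Comp_arr)
    then have "\<dots> \<cdot> \<a> U V U = (s2 \<cdot> s3 \<cdot> (\<i>\<d> U \<otimes>\<^sub>a A)) \<cdot> \<a> U V U" by simp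
    then show ?thesis by (simp add: D_def)
  qed
  have r2: "\<c> V U \<otimes>\<^sub>a \<i>\<d> U = (A \<otimes>\<^sub>a \<i>\<d> U) \<cdot> ((\<c> U U \<otimes>\<^sub>a \<i>\<d> U) \<otimes>\<^sub>a \<i>\<d> U) \<cdot> (A' \<otimes>\<^sub>a \<i>\<d> U)
      \<cdot> ((\<i>\<d> U \<otimes>\<^sub>a \<c> U U) \<otimes>\<^sub>a \<i>\<d> U) \<cdot> (A \<otimes>\<^sub>a \<i>\<d> U)"
    by (simp add: cVU TensA_Comp_arr)
  \<comment> \<open>\<open>n1\<close> to \<open>n3\<close> absorb the factors of \<open>r2\<close>:
    naturality of the associator turns the braidings into \<open>s1\<close> and \<open>s2\<close>,
    and the pentagon changes between the bracketings.\<close>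
  have n1: "\<alpha> \<cdot> \<beta> \<cdot> ((\<c> U U \<otimes>\<^sub>a \<i>\<d> U) \<otimes>\<^sub>a \<i>\<d> U) = s1 \<cdot> \<alpha> \<cdot> \<beta>"
  proof -
    have "\<beta> \<cdot> ((\<c> U U \<otimes>\<^sub>a \<i>\<d> U) \<otimes>\<^sub>a \<i>\<d> U) = (\<c> U U \<otimes>\<^sub>a \<i>\<d> V) \<cdot> \<beta>"
      using Assoc_natural_arr[of "\<c> U U" "\<i>\<d> U" "\<i>\<d> U"] by (simp add: \<beta>_def)
    then show ?thesis by (simp add: s1_def)
  qed
  have n2: "D \<cdot> ((\<i>\<d> U \<otimes>\<^sub>a \<c> U U) \<otimes>\<^sub>a \<i>\<d> U) = s2 \<cdot> D"
  proof -
    have *: "\<a> U V U \<cdot> ((\<i>\<d> U \<otimes>\<^sub>a \<c> U U) \<otimes>\<^sub>a \<i>\<d> U) = (\<i>\<d> U \<otimes>\<^sub>a (\<c> U U \<otimes>\<^sub>a \<i>\<d> U)) \<cdot> \<a> U V U"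
      using Assoc_natural_arr[of "\<i>\<d> U" "\<c> U U" "\<i>\<d> U"] by simp
    have "(\<i>\<d> U \<otimes>\<^sub>a A) \<cdot> (\<i>\<d> U \<otimes>\<^sub>a (\<c> U U \<otimes>\<^sub>a \<i>\<d> U)) = s2 \<cdot> (\<i>\<d> U \<otimes>\<^sub>a A)"
      by (simp add: s2_def TensA_Comp_arr)
    from Comp_cancel_right[OF this, of "\<a> U V U"] * show ?thesis by (simp add: D_def)
  qed
  have n3: "\<alpha> \<cdot> \<beta> \<cdot> (A' \<otimes>\<^sub>a \<i>\<d> U) = D"
  proof -
    have "\<alpha> \<cdot> \<beta> \<cdot> (A' \<otimes>\<^sub>a \<i>\<d> U) = (D \<cdot> (A \<otimes>\<^sub>a \<i>\<d> U)) \<cdot> (A' \<otimes>\<^sub>a \<i>\<d> U)"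
      by (simp only: pent) simp
    then show ?thesis by (simp add: TensA_Comp_arr)
  qed
  \<comment> \<open>The first hexagon splits the right-hand \<open>V\<close>, so the left-hand block
    passes one copy of \<open>U\<close> at a time.\<close>
  have "\<alpha> \<cdot> \<c> V V = (\<i>\<d> U \<otimes>\<^sub>a \<c> V U) \<cdot> \<a> U V U \<cdot> (\<c> V U \<otimes>\<^sub>a \<i>\<d> U) \<cdot> inv_arr C \<beta>"
    using Braid_TensO_right[of V U U] by (simp add: \<alpha>_def \<beta>_def)
  also have "\<dots> = ((\<i>\<d> U \<otimes>\<^sub>a \<c> V U) \<cdot> \<a> U V U) \<cdot> (\<c> V U \<otimes>\<^sub>a \<i>\<d> U) \<cdot> inv_arr C \<beta>"
    by simp
  \<comment> \<open>From here the inner parentheses isolate the subword that the next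
    \<open>simp only\<close> replaces; full simplification would right-nest it out of reach.\<close>
  also have "\<dots> = s2 \<cdot> s3 \<cdot> (D \<cdot> (A \<otimes>\<^sub>a \<i>\<d> U)) \<cdot> ((\<c> U U \<otimes>\<^sub>a \<i>\<d> U) \<otimes>\<^sub>a \<i>\<d> U) \<cdot> (A' \<otimes>\<^sub>a \<i>\<d> U)
      \<cdot> ((\<i>\<d> U \<otimes>\<^sub>a \<c> U U) \<otimes>\<^sub>a \<i>\<d> U) \<cdot> (A \<otimes>\<^sub>a \<i>\<d> U) \<cdot> inv_arr C \<beta>"
    by (simp add: r1 r2)
  also have "\<dots> = s2 \<cdot> s3 \<cdot> (\<alpha> \<cdot> \<beta> \<cdot> ((\<c> U U \<otimes>\<^sub>a \<i>\<d> U) \<otimes>\<^sub>a \<i>\<d> U)) \<cdot> (A' \<otimes>\<^sub>a \<i>\<d> U)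
      \<cdot> ((\<i>\<d> U \<otimes>\<^sub>a \<c> U U) \<otimes>\<^sub>a \<i>\<d> U) \<cdot> (A \<otimes>\<^sub>a \<i>\<d> U) \<cdot> inv_arr C \<beta>"
    by (simp only: pent) simp
  also have "\<dots> = s2 \<cdot> s3 \<cdot> s1 \<cdot> (\<alpha> \<cdot> \<beta> \<cdot> (A' \<otimes>\<^sub>a \<i>\<d> U))
      \<cdot> ((\<i>\<d> U \<otimes>\<^sub>a \<c> U U) \<otimes>\<^sub>a \<i>\<d> U) \<cdot> (A \<otimes>\<^sub>a \<i>\<d> U) \<cdot> inv_arr C \<beta>"
    by (simp only: n1) simp
  also have "\<dots> = s2 \<cdot> s3 \<cdot> s1 \<cdot> (D \<cdot> ((\<i>\<d> U \<otimes>\<^sub>a \<c> U U) \<otimes>\<^sub>a \<i>\<d> U)) \<cdot> (A \<otimes>\<^sub>a \<i>\<d> U) \<cdot> inv_arr C \<beta>"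
    by (simp only: n3) simp
  also have "\<dots> = s2 \<cdot> s3 \<cdot> s1 \<cdot> s2 \<cdot> (D \<cdot> (A \<otimes>\<^sub>a \<i>\<d> U)) \<cdot> inv_arr C \<beta>"
    by (simp only: n2) simp
  also have "\<dots> = s2 \<cdot> s3 \<cdot> s1 \<cdot> s2 \<cdot> \<alpha>"
    by (simp only: pent) simp
  finally have block: "\<alpha> \<cdot> \<c> V V = s2 \<cdot> s3 \<cdot> s1 \<cdot> s2 \<cdot> \<alpha>" .
  have "\<c> V V \<cdot> middle_braid C U = \<alpha>' \<cdot> (\<alpha> \<cdot> \<c> V V) \<cdot> \<alpha>' \<cdot> s2 \<cdot> \<alpha>"
    by (simp add: M)
  also have "\<dots> = \<alpha>' \<cdot> s2 \<cdot> s3 \<cdot> s1 \<cdot> (s2 \<cdot> s2) \<cdot> \<alpha>"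
    by (simp only: block) simp
  also have "\<dots> = \<alpha>' \<cdot> s2 \<cdot> s3 \<cdot> (s1 \<cdot> \<alpha>)"
    by (simp add: s2s2)
  also have "\<dots> = \<alpha>' \<cdot> s2 \<cdot> (s3 \<cdot> \<alpha>) \<cdot> (\<c> U U \<otimes>\<^sub>a \<i>\<d> V)"
    by (simp only: s1) simp
  also have "\<dots> = \<alpha>' \<cdot> s2 \<cdot> \<alpha> \<cdot> (\<i>\<d> V \<otimes>\<^sub>a \<c> U U) \<cdot> (\<c> U U \<otimes>\<^sub>a \<i>\<d> V)"
    by (simp only: s3) simp
  also have "\<dots> = middle_braid C U \<cdot> (\<c> U U \<otimes>\<^sub>a \<c> U U)"
    by (simp add: M TensA_Comp_arr)
  finally show ?thesis by simp
qed

section \<open>The induced multiplication on \<open>U \<otimes> U\<close>\<close>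

lemma middle_braid_arr [simp]:
  assumes "U \<in> Obj C"
  shows "middle_braid C U \<in> Arr C" "Dom C (middle_braid C U) = (U \<otimes>\<^sub>o U) \<otimes>\<^sub>o U \<otimes>\<^sub>o U"
    "Cod C (middle_braid C U) = (U \<otimes>\<^sub>o U) \<otimes>\<^sub>o U \<otimes>\<^sub>o U"
  using assms by (simp_all add: middle_braid_def)

lemma mu_hat_arr [simp]:
  assumes "is_algebra_object C U \<mu>"
  shows "mu_hat C U \<mu> \<in> Arr C" "Dom C (mu_hat C U \<mu>) = (U \<otimes>\<^sub>o U) \<otimes>\<^sub>o U \<otimes>\<^sub>o U"
    "Cod C (mu_hat C U \<mu>) = U \<otimes>\<^sub>o U"
  using assms by (simp_all add: mu_hat_def is_algebra_object_def in_hom_set_iff)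

text \<open>Naturality moves \<open>c\<close> through \<open>\<mu> \<otimes> \<mu>\<close>, where it
  becomes the braiding of \<open>U \<otimes> U\<close> with itself;
  \<open>Braid_middle_braid\<close> then carries it past the middle braiding as
  \<open>c \<otimes> c\<close>.\<close>

lemma Braid_mu_hat:
  assumes "is_algebra_object C U \<mu>"
  shows "\<c> U U \<cdot> mu_hat C U \<mu> = mu_hat C U \<mu> \<cdot> (\<c> U U \<otimes>\<^sub>a \<c> U U)"
proof -
  have *: "U \<in> Obj C" "\<mu> \<in> hom_set C (U \<otimes>\<^sub>o U) U" "\<mu> \<in> Arr C" "Dom C \<mu> = U \<otimes>\<^sub>o U" "Cod C \<mu> = U"
    using assms by (simp_all add: is_algebra_object_def in_hom_set_iff)
  from Braid_natural[OF *(2,2)] have "\<c> U U \<cdot> mu_hat C U \<mu>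
      = (\<mu> \<otimes>\<^sub>a \<mu>) \<cdot> \<c> (U \<otimes>\<^sub>o U) (U \<otimes>\<^sub>o U) \<cdot> middle_braid C U"
    using * Comp_cancel_right[of "\<c> U U" "\<mu> \<otimes>\<^sub>a \<mu>" _ "middle_braid C U"] by (simp add: mu_hat_def)
  with * show ?thesis by (simp add: Braid_middle_braid mu_hat_def)
qed

end

section \<open>Additive structure of the hom-sets\<close>

context linear_category
begin

text \<open>Composition is only known to distribute over \<open>Plus\<close>. So \<open>f\<close> is
  written as the difference plus \<open>g\<close>, and \<open>g \<cdot> h\<close> is cancelled in
  the hom-module, which avoids negatives of composites.\<close>

lemma Comp_minus_eq_Zero_iff:
  assumes "f \<in> hom_set C Y Z" "g \<in> hom_set C Y Z" "h \<in> hom_set C X Y"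
  shows "(f \<ominus>\<^bsub>hom_module C Y Z\<^esub> g) \<cdot> h = Zero C X Z \<longleftrightarrow> f \<cdot> h = g \<cdot> h"
proof -
  have obj: "X \<in> Obj C" "Y \<in> Obj C" "Z \<in> Obj C"
    using assms Dom_in_Obj Cod_in_Obj by (auto simp: in_hom_set_iff)
  interpret H: module K "hom_module C Y Z" by (rule hom_module) (use obj in auto)
  interpret G: module K "hom_module C X Z" by (rule hom_module) (use obj in auto)
  define d where "d = f \<ominus>\<^bsub>hom_module C Y Z\<^esub> g"
  have carr: "carrier (hom_module C X' Y') = hom_set C X' Y'" for X' Y'
    by (simp add: hom_module_def)
  have plus: "add (hom_module C X' Y') = Plus C" for X' Y'
    by (simp add: hom_module_def)
  have zero: "zero (hom_module C X' Y') = Zero C X' Y'" for X' Y'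
    by (simp add: hom_module_def)
  have d: "d \<in> hom_set C Y Z"
    using H.minus_closed[of f g] assms by (simp add: d_def carr)
  have "d \<^bold>+ g = f"
    using H.minus_eq[of f g] H.a_assoc[of f "\<ominus>\<^bsub>hom_module C Y Z\<^esub> g" g] H.l_neg[of g]
      H.r_zero[of f] H.a_inv_closed[of g] assms by (simp add: d_def carr plus)
  then have eq: "f \<cdot> h = (d \<cdot> h) \<^bold>+ (g \<cdot> h)"
    using Comp_Plus_left[OF assms(3) d assms(2)] by simp
  have hom: "d \<cdot> h \<in> hom_set C X Z" "g \<cdot> h \<in> hom_set C X Z"
    using Comp_in_hom assms d by blast+
  have "f \<cdot> h = g \<cdot> h \<longleftrightarrow> (d \<cdot> h) \<oplus>\<^bsub>hom_module C X Z\<^esub> (g \<cdot> h) = \<zero>\<^bsub>hom_module C X Z\<^esub> \<oplus>\<^bsub>hom_module C X Z\<^esub> (g \<cdot> h)"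
    using eq G.l_zero[of "g \<cdot> h"] hom by (simp add: carr plus)
  also have "\<dots> \<longleftrightarrow> d \<cdot> h = \<zero>\<^bsub>hom_module C X Z\<^esub>"
    by (rule G.add.right_cancel) (use hom G.zero_closed in \<open>auto simp: carr\<close>)
  finally show ?thesis by (simp add: d_def zero)
qed

lemma Plus_in_hom:
  assumes "f \<in> hom_set C X Y" "g \<in> hom_set C X Y"
  shows "f \<^bold>+ g \<in> hom_set C X Y"
proof -
  interpret H: module K "hom_module C X Y"
    by (rule hom_module) (use assms Dom_in_Obj Cod_in_Obj in \<open>auto simp: in_hom_set_iff\<close>)
  show ?thesis using H.add.m_closed[of f g] assms by (simp add: hom_module_def)
qed

lemma Plus_commute:
  assumes "f \<in> hom_set C X Y" "g \<in> hom_set C X Y"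
  shows "f \<^bold>+ g = g \<^bold>+ f"
proof -
  interpret H: module K "hom_module C X Y"
    by (rule hom_module) (use assms Dom_in_Obj Cod_in_Obj in \<open>auto simp: in_hom_set_iff\<close>)
  show ?thesis using H.a_comm[of f g] assms by (simp add: hom_module_def)
qed

end

section \<open>The symmetric square, its structure maps, and forms on it\<close>

context symmetric_tensor_category
begin

text \<open>The map \<open>\<i>\<d> - c\<close> kills \<open>h\<close> exactly when
  \<open>c \<cdot> h = h\<close>, so its kernel is the universal map fixed by \<open>c\<close>.
  Later arguments use this subtraction-free form.\<close>

lemma Gamma2_props:
  assumes "is_Gamma2 C U \<Gamma> \<iota>"
  shows "U \<in> Obj C" "\<Gamma> \<in> Obj C" "\<iota> \<in> hom_set C \<Gamma> (U \<otimes>\<^sub>o U)" "\<c> U U \<cdot> \<iota> = \<iota>"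
    and "\<lbrakk>h \<in> hom_set C X (U \<otimes>\<^sub>o U); \<c> U U \<cdot> h = h\<rbrakk> \<Longrightarrow> \<exists>!u. u \<in> hom_set C X \<Gamma> \<and> \<iota> \<cdot> u = h"
proof -
  let ?V = "U \<otimes>\<^sub>o U"
  let ?d = "\<i>\<d> ?V \<ominus>\<^bsub>hom_module C ?V ?V\<^esub> \<c> U U"
  have U: "U \<in> Obj C" and ker: "is_kernel C ?d \<Gamma> \<iota>"
    using assms by (simp_all add: is_Gamma2_def)
  then have hom: "\<i>\<d> ?V \<in> hom_set C ?V ?V" "\<c> U U \<in> hom_set C ?V ?V"
    by (simp_all add: Ident_in_hom Braid_in_hom)
  interpret H: module K "hom_module C ?V ?V"
    by (rule hom_module) (use U in simp_all)
  have "?d \<in> hom_set C ?V ?V"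
    using H.minus_closed[of "\<i>\<d> ?V" "\<c> U U"] hom by (simp add: hom_module_def)
  then have d: "Dom C ?d = ?V" "Cod C ?d = ?V" by (simp_all add: in_hom_set_iff)
  have iff: "?d \<cdot> h = Zero C X ?V \<longleftrightarrow> \<c> U U \<cdot> h = h" if "h \<in> hom_set C X ?V" for h X
    using Comp_minus_eq_Zero_iff[OF hom that] Ident_left[OF that] by auto
  show "U \<in> Obj C" by (rule U)
  show "\<Gamma> \<in> Obj C" and \<iota>: "\<iota> \<in> hom_set C \<Gamma> ?V"
    using ker d by (simp_all add: is_kernel_def)
  show "\<c> U U \<cdot> \<iota> = \<iota>"
    using ker d iff[OF \<iota>] by (simp add: is_kernel_def)
  show "\<exists>!u. u \<in> hom_set C X \<Gamma> \<and> \<iota> \<cdot> u = h" if "h \<in> hom_set C X ?V" "\<c> U U \<cdot> h = h" for X h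
  proof -
    have "X \<in> Obj C" using that Dom_in_Obj by (auto simp: in_hom_set_iff)
    with ker d iff[OF that(1)] that show ?thesis by (simp add: is_kernel_def)
  qed
qed

text \<open>\<open>\<iota> \<cdot> v\<close> inherits invariance under \<open>c\<close> from
  \<open>\<iota>\<close>, and \<open>u\<close> and \<open>v\<close> both factor it, so uniqueness of
  the factorization applies.\<close>

lemma Gamma2_mono:
  assumes "is_Gamma2 C U \<Gamma> \<iota>" "u \<in> hom_set C X \<Gamma>" "v \<in> hom_set C X \<Gamma>" "\<iota> \<cdot> u = \<iota> \<cdot> v"
  shows "u = v"
proof -
  note G = Gamma2_props[OF assms(1)]
  have "\<iota> \<cdot> v \<in> hom_set C X (U \<otimes>\<^sub>o U)" by (rule Comp_in_hom[OF assms(3) G(3)])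
  moreover have "\<c> U U \<cdot> \<iota> \<cdot> v = \<iota> \<cdot> v"
    using Comp_assoc[OF assms(3) G(3) Braid_in_hom[OF G(1) G(1)]] G(4) by simp
  ultimately show ?thesis using G(5) assms(2-4) by blast
qed

text \<open>Symmetry gives \<open>c \<cdot> (\<i>\<d> + c) = c + \<i>\<d>\<close>, so
  \<open>\<i>\<d> + c\<close> is invariant and factors uniquely through
  \<open>\<iota>\<close>.\<close>

lemma rho_props:
  assumes "is_Gamma2 C U \<Gamma> \<iota>"
  shows "rho C U \<Gamma> \<iota> \<in> hom_set C (U \<otimes>\<^sub>o U) \<Gamma>"
    and "\<iota> \<cdot> rho C U \<Gamma> \<iota> = \<i>\<d> (U \<otimes>\<^sub>o U) \<^bold>+ \<c> U U"
proof -
  let ?V = "U \<otimes>\<^sub>o U"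
  note G = Gamma2_props[OF assms]
  have hom: "\<i>\<d> ?V \<in> hom_set C ?V ?V" "\<c> U U \<in> hom_set C ?V ?V"
    using G(1) by (simp_all add: Ident_in_hom Braid_in_hom)
  have "\<c> U U \<cdot> (\<i>\<d> ?V \<^bold>+ \<c> U U) = \<c> U U \<^bold>+ \<i>\<d> ?V"
    using Comp_Plus_right[OF hom hom(2)] Ident_right[OF hom(2)] G(1) by simp
  also have "\<dots> = \<i>\<d> ?V \<^bold>+ \<c> U U" by (rule Plus_commute[OF hom(2,1)])
  finally have "\<exists>!r. r \<in> hom_set C ?V \<Gamma> \<and> \<iota> \<cdot> r = \<i>\<d> ?V \<^bold>+ \<c> U U"
    by (intro G(5) Plus_in_hom hom)
  from theI'[OF this]
  show "rho C U \<Gamma> \<iota> \<in> hom_set C ?V \<Gamma>" "\<iota> \<cdot> rho C U \<Gamma> \<iota> = \<i>\<d> ?V \<^bold>+ \<c> U U"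
    by (simp_all add: rho_def)
qed

text \<open>Pushed through \<open>mu_hat\<close>, \<open>c\<close> becomes
  \<open>c \<otimes> c\<close>, which \<open>\<iota> \<otimes> \<iota>\<close> absorbs; hence the
  required factorization exists and is unique.\<close>

lemma mu_tilde_props:
  assumes "is_Gamma2 C U \<Gamma> \<iota>" "is_algebra_object C U \<mu>"
  shows "mu_tilde C U \<mu> \<Gamma> \<iota> \<in> hom_set C (\<Gamma> \<otimes>\<^sub>o \<Gamma>) \<Gamma>"
    and "\<iota> \<cdot> mu_tilde C U \<mu> \<Gamma> \<iota> = mu_hat C U \<mu> \<cdot> (\<iota> \<otimes>\<^sub>a \<iota>)"
proof -
  note G = Gamma2_props[OF assms(1)]
  have \<iota>: "\<iota> \<in> Arr C" "Dom C \<iota> = \<Gamma>" "Cod C \<iota> = U \<otimes>\<^sub>o U"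
    using G(3) by (simp_all add: in_hom_set_iff)
  have "\<c> U U \<cdot> mu_hat C U \<mu> \<cdot> (\<iota> \<otimes>\<^sub>a \<iota>) = (\<c> U U \<cdot> mu_hat C U \<mu>) \<cdot> (\<iota> \<otimes>\<^sub>a \<iota>)"
    using G(1) \<iota> assms(2) by simp
  also have "\<dots> = mu_hat C U \<mu> \<cdot> (\<iota> \<otimes>\<^sub>a \<iota>)"
    using G \<iota> assms(2) by (simp add: Braid_mu_hat TensA_Comp_arr)
  finally have "\<exists>!t. t \<in> hom_set C (\<Gamma> \<otimes>\<^sub>o \<Gamma>) \<Gamma> \<and> \<iota> \<cdot> t = mu_hat C U \<mu> \<cdot> (\<iota> \<otimes>\<^sub>a \<iota>)"
    by (intro G(5)) (use \<iota> assms(2) in \<open>simp_all add: in_hom_set_iff\<close>)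
  from theI'[OF this]
  show "mu_tilde C U \<mu> \<Gamma> \<iota> \<in> hom_set C (\<Gamma> \<otimes>\<^sub>o \<Gamma>) \<Gamma>"
    "\<iota> \<cdot> mu_tilde C U \<mu> \<Gamma> \<iota> = mu_hat C U \<mu> \<cdot> (\<iota> \<otimes>\<^sub>a \<iota>)"
    by (simp_all add: mu_tilde_def)
qed

text \<open>
  Covers both sides at once: \<open>x\<close> and \<open>y\<close> become \<open>\<i>\<d>\<close> and \<open>\<rho>\<close> (in either order), with
  \<open>\<iota> \<otimes> \<i>\<d>\<close> or \<open>\<i>\<d> \<otimes> \<iota>\<close> as \<open>f\<close>.
\<close>

lemma mu_tilde_Comp_eq:
  assumes G: "is_Gamma2 C U \<Gamma> \<iota>" and A: "is_algebra_object C U \<mu>"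
    and x: "x \<in> hom_set C X \<Gamma>" and y: "y \<in> hom_set C Y \<Gamma>"
    and f: "f \<in> hom_set C (X \<otimes>\<^sub>o Y) ((U \<otimes>\<^sub>o U) \<otimes>\<^sub>o U \<otimes>\<^sub>o U)"
    and eq: "(\<iota> \<cdot> x) \<otimes>\<^sub>a (\<iota> \<cdot> y) = f \<^bold>+ ((\<c> U U \<otimes>\<^sub>a \<c> U U) \<cdot> f)"
  shows "mu_tilde C U \<mu> \<Gamma> \<iota> \<cdot> (x \<otimes>\<^sub>a y) = rho C U \<Gamma> \<iota> \<cdot> mu_hat C U \<mu> \<cdot> f"
proof -
  let ?V = "U \<otimes>\<^sub>o U"
  note G' = Gamma2_props[OF G] and t = mu_tilde_props[OF G A] and r = rho_props[OF G]
  have c: "\<c> U U \<in> hom_set C ?V ?V" by (rule Braid_in_hom[OF G'(1,1)])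
  have id: "\<i>\<d> ?V \<in> hom_set C ?V ?V" using G'(1) by (simp add: Ident_in_hom)
  have m: "mu_hat C U \<mu> \<in> hom_set C (?V \<otimes>\<^sub>o ?V) ?V" using A by (simp add: in_hom_set_iff)
  have xy: "x \<otimes>\<^sub>a y \<in> hom_set C (X \<otimes>\<^sub>o Y) (\<Gamma> \<otimes>\<^sub>o \<Gamma>)" by (rule TensA_in_hom[OF x y])
  have cc: "\<c> U U \<otimes>\<^sub>a \<c> U U \<in> hom_set C (?V \<otimes>\<^sub>o ?V) (?V \<otimes>\<^sub>o ?V)" by (rule TensA_in_hom[OF c c])
  have mf: "mu_hat C U \<mu> \<cdot> f \<in> hom_set C (X \<otimes>\<^sub>o Y) ?V" by (rule Comp_in_hom[OF f m])
  have "\<iota> \<cdot> mu_tilde C U \<mu> \<Gamma> \<iota> \<cdot> (x \<otimes>\<^sub>a y) = mu_hat C U \<mu> \<cdot> ((\<iota> \<cdot> x) \<otimes>\<^sub>a (\<iota> \<cdot> y))"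
    using Comp_assoc[OF xy t(1) G'(3)] t(2) TensA_Comp[OF x G'(3) y G'(3)]
      Comp_assoc[OF xy TensA_in_hom[OF G'(3,3)] m] by simp
  \<comment> \<open>\<open>eq\<close> presents the argument as the sum of \<open>f\<close> and its
    image under \<open>c \<otimes> c\<close>. Moving the latter out of \<open>mu_hat\<close> as
    \<open>c\<close> leaves a left factor \<open>\<i>\<d> + c\<close>, which is
    \<open>\<iota> \<cdot> \<rho>\<close>.\<close>
  also have "\<dots> = (mu_hat C U \<mu> \<cdot> f) \<^bold>+ (\<c> U U \<cdot> mu_hat C U \<mu> \<cdot> f)"
    using eq Comp_Plus_right[OF f Comp_in_hom[OF f cc] m] Comp_assoc[OF f cc m]
      Comp_assoc[OF f m c] Braid_mu_hat[OF A] by simp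
  also have "\<dots> = (\<i>\<d> ?V \<^bold>+ \<c> U U) \<cdot> mu_hat C U \<mu> \<cdot> f"
    using Comp_Plus_left[OF mf id c] Ident_left[OF mf] by simp
  also have "\<dots> = \<iota> \<cdot> rho C U \<Gamma> \<iota> \<cdot> mu_hat C U \<mu> \<cdot> f"
    using Comp_assoc[OF mf r(1) G'(3)] r(2) by simp
  finally show ?thesis
    by (rule Gamma2_mono[OF G Comp_in_hom[OF xy t(1)] Comp_in_hom[OF mf r(1)]])
qed

lemma form_tensor_Comp:
  assumes "p \<in> hom_set C X \<I>" "q \<in> hom_set C Y \<I>" "f \<in> hom_set C X' X" "g \<in> hom_set C Y' Y"
  shows "form_tensor C (p \<cdot> f) (q \<cdot> g) = form_tensor C p q \<cdot> (f \<otimes>\<^sub>a g)"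
  using TensA_Comp[OF assms(3,1,4,2)]
    Comp_assoc[OF TensA_in_hom[OF assms(3,4)] TensA_in_hom[OF assms(1,2)] LUnit_in_hom]
  by (simp add: form_tensor_def)

text \<open>Multiplicativity replaces the product of two copies of \<open>Q\<close> by
  \<open>Q \<cdot> mu_tilde\<close>; \<open>mu_tilde_Comp_eq\<close> then produces
  \<open>\<rho>\<close>, and \<open>Q \<cdot> \<rho>\<close> is the bilinear form. Both partial
  linearizations are instances.\<close>

lemma form_tensor_linearization:
  assumes G: "is_Gamma2 C U \<Gamma> \<iota>" and A: "is_algebra_object C U \<mu>"
    and Q: "is_quadratic_form C \<Gamma> Q" and M: "is_multiplicative C U \<mu> \<Gamma> \<iota> Q"
    and x: "x \<in> hom_set C X \<Gamma>" and y: "y \<in> hom_set C Y \<Gamma>"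
    and f: "f \<in> hom_set C (X \<otimes>\<^sub>o Y) ((U \<otimes>\<^sub>o U) \<otimes>\<^sub>o U \<otimes>\<^sub>o U)"
    and eq: "(\<iota> \<cdot> x) \<otimes>\<^sub>a (\<iota> \<cdot> y) = f \<^bold>+ ((\<c> U U \<otimes>\<^sub>a \<c> U U) \<cdot> f)"
  shows "form_tensor C (Q \<cdot> x) (Q \<cdot> y) = bilinear_form_of C U \<Gamma> \<iota> Q \<cdot> mu_hat C U \<mu> \<cdot> f"
proof -
  note t = mu_tilde_props[OF G A] and r = rho_props[OF G]
  have Q': "Q \<in> hom_set C \<Gamma> \<I>" using Q by (simp add: is_quadratic_form_def)
  have m: "mu_hat C U \<mu> \<in> hom_set C ((U \<otimes>\<^sub>o U) \<otimes>\<^sub>o U \<otimes>\<^sub>o U) (U \<otimes>\<^sub>o U)"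
    using A by (simp add: in_hom_set_iff)
  have "form_tensor C (Q \<cdot> x) (Q \<cdot> y) = (Q \<cdot> mu_tilde C U \<mu> \<Gamma> \<iota>) \<cdot> (x \<otimes>\<^sub>a y)"
    using form_tensor_Comp[OF Q' Q' x y] M by (simp add: is_multiplicative_def)
  also have "\<dots> = Q \<cdot> rho C U \<Gamma> \<iota> \<cdot> mu_hat C U \<mu> \<cdot> f"
    using Comp_assoc[OF TensA_in_hom[OF x y] t(1) Q'] mu_tilde_Comp_eq[OF G A x y f eq] by simp
  also have "\<dots> = bilinear_form_of C U \<Gamma> \<iota> Q \<cdot> mu_hat C U \<mu> \<cdot> f"
    using Comp_assoc[OF Comp_in_hom[OF f m] r(1) Q'] by (simp add: bilinear_form_of_def)
  finally show ?thesis .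
qed

end

theorem proposition3p4:
  fixes K :: "('k, 'r) ring_scheme"
    and C :: "('k, 'o, 'm, 'z) tensor_data_scheme" (structure)
    and U \<Gamma> :: 'o and \<mu> \<iota> Q B :: 'm
  assumes "symmetric_tensor_category K C"
    and "is_algebra_object C U \<mu>"
    and "is_Gamma2 C U \<Gamma> \<iota>"
    and "is_quadratic_form C \<Gamma> Q"
    and "is_multiplicative C U \<mu> \<Gamma> \<iota> Q"
    and "B = bilinear_form_of C U \<Gamma> \<iota> Q"
  shows "(form_tensor C Q B = B \<cdot> mu_hat C U \<mu> \<cdot> (\<iota> \<otimes>\<^sub>a \<i>\<d> (U \<otimes>\<^sub>o U))) \<and>
    (form_tensor C B Q = B \<cdot> mu_hat C U \<mu> \<cdot> (\<i>\<d> (U \<otimes>\<^sub>o U) \<otimes>\<^sub>a \<iota>)) \<and>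
    (form_tensor C B B = B \<cdot> mu_hat C U \<mu> \<cdot> ((\<i>\<d> (U \<otimes>\<^sub>o U) \<^bold>+ \<c> U U) \<otimes>\<^sub>a \<i>\<d> (U \<otimes>\<^sub>o U))) \<and>
    (form_tensor C B B = B \<cdot> mu_hat C U \<mu> \<cdot> (\<i>\<d> (U \<otimes>\<^sub>o U) \<otimes>\<^sub>a (\<i>\<d> (U \<otimes>\<^sub>o U) \<^bold>+ \<c> U U)))"
proof -
  interpret symmetric_tensor_category K C by (rule assms(1))
  let ?V = "U \<otimes>\<^sub>o U" and ?\<rho> = "rho C U \<Gamma> \<iota>" and ?m = "mu_hat C U \<mu>"
  note G = Gamma2_props[OF assms(3)] and r = rho_props[OF assms(3)]
  have Q: "Q \<in> hom_set C \<Gamma> \<I>" using assms(4) by (simp add: is_quadratic_form_def)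
  have B: "B = Q \<cdot> ?\<rho>" by (simp add: assms(6) bilinear_form_of_def)
  have Bh: "B \<in> hom_set C ?V \<I>" unfolding B by (rule Comp_in_hom[OF r(1) Q])
  have c: "\<c> U U \<in> hom_set C ?V ?V" by (rule Braid_in_hom[OF G(1,1)])
  have idV: "\<i>\<d> ?V \<in> hom_set C ?V ?V" using G(1) by (simp add: Ident_in_hom)
  have id\<Gamma>: "\<i>\<d> \<Gamma> \<in> hom_set C \<Gamma> \<Gamma>" using G(2) by (simp add: Ident_in_hom)
  have m: "?m \<in> hom_set C (?V \<otimes>\<^sub>o ?V) ?V" using assms(2) by (simp add: in_hom_set_iff)
  have \<iota>V: "\<iota> \<otimes>\<^sub>a \<i>\<d> ?V \<in> hom_set C (\<Gamma> \<otimes>\<^sub>o ?V) (?V \<otimes>\<^sub>o ?V)" by (rule TensA_in_hom[OF G(3) idV])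
  have V\<iota>: "\<i>\<d> ?V \<otimes>\<^sub>a \<iota> \<in> hom_set C (?V \<otimes>\<^sub>o \<Gamma>) (?V \<otimes>\<^sub>o ?V)" by (rule TensA_in_hom[OF idV G(3)])
  \<comment> \<open>Expanding \<open>\<iota> \<cdot> \<rho> = \<i>\<d> + c\<close> gives a second
    summand \<open>\<iota> \<otimes> c\<close>. As \<open>c \<cdot> \<iota> = \<iota>\<close>, it is
    the image of \<open>\<iota> \<otimes> \<i>\<d>\<close> under
    \<open>c \<otimes> c\<close>.\<close>
  have "(\<iota> \<cdot> \<i>\<d> \<Gamma>) \<otimes>\<^sub>a (\<iota> \<cdot> ?\<rho>) = \<iota> \<otimes>\<^sub>a \<i>\<d> ?V \<^bold>+ ((\<c> U U \<otimes>\<^sub>a \<c> U U) \<cdot> (\<iota> \<otimes>\<^sub>a \<i>\<d> ?V))"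
    using TensA_Plus_right[OF G(3) idV c] TensA_Comp[OF G(3) c idV c] Ident_right[OF G(3)]
      Ident_right[OF c] G(4) r(2) by simp
  from form_tensor_linearization[OF assms(3,2,4,5) id\<Gamma> r(1) \<iota>V this]
  have right: "form_tensor C Q B = B \<cdot> ?m \<cdot> (\<iota> \<otimes>\<^sub>a \<i>\<d> ?V)"
    using Ident_right[OF Q] by (simp flip: B assms(6))
  have "(\<iota> \<cdot> ?\<rho>) \<otimes>\<^sub>a (\<iota> \<cdot> \<i>\<d> \<Gamma>) = \<i>\<d> ?V \<otimes>\<^sub>a \<iota> \<^bold>+ ((\<c> U U \<otimes>\<^sub>a \<c> U U) \<cdot> (\<i>\<d> ?V \<otimes>\<^sub>a \<iota>))"
    using TensA_Plus_left[OF idV c G(3)] TensA_Comp[OF idV c G(3) c] Ident_right[OF G(3)]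
      Ident_right[OF c] G(4) r(2) by simp
  from form_tensor_linearization[OF assms(3,2,4,5) r(1) id\<Gamma> V\<iota> this]
  have left: "form_tensor C B Q = B \<cdot> ?m \<cdot> (\<i>\<d> ?V \<otimes>\<^sub>a \<iota>)"
    using Ident_right[OF Q] by (simp flip: B assms(6))
  have \<rho>V: "?\<rho> \<otimes>\<^sub>a \<i>\<d> ?V \<in> hom_set C (?V \<otimes>\<^sub>o ?V) (\<Gamma> \<otimes>\<^sub>o ?V)" by (rule TensA_in_hom[OF r(1) idV])
  have V\<rho>: "\<i>\<d> ?V \<otimes>\<^sub>a ?\<rho> \<in> hom_set C (?V \<otimes>\<^sub>o ?V) (?V \<otimes>\<^sub>o \<Gamma>)" by (rule TensA_in_hom[OF idV r(1)])
  \<comment> \<open>Precomposing the right linearization with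
    \<open>\<rho> \<otimes> \<i>\<d>\<close> turns \<open>Q\<close> into \<open>B\<close> and
    \<open>\<iota>\<close> into \<open>\<i>\<d> + c\<close>; the other formula for
    \<open>B \<otimes> B\<close> arises likewise from the left linearization.\<close>
  have "form_tensor C B B = form_tensor C Q B \<cdot> (?\<rho> \<otimes>\<^sub>a \<i>\<d> ?V)"
    using form_tensor_Comp[OF Q Bh r(1) idV] Ident_right[OF Bh] by (simp flip: B)
  also have "\<dots> = B \<cdot> ?m \<cdot> (\<iota> \<otimes>\<^sub>a \<i>\<d> ?V) \<cdot> (?\<rho> \<otimes>\<^sub>a \<i>\<d> ?V)"
    using Comp_assoc[OF \<rho>V Comp_in_hom[OF \<iota>V m] Bh] Comp_assoc[OF \<rho>V \<iota>V m] by (simp add: right)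
  also have "(\<iota> \<otimes>\<^sub>a \<i>\<d> ?V) \<cdot> (?\<rho> \<otimes>\<^sub>a \<i>\<d> ?V) = (\<i>\<d> ?V \<^bold>+ \<c> U U) \<otimes>\<^sub>a \<i>\<d> ?V"
    using TensA_Comp[OF r(1) G(3) idV idV] Ident_right[OF idV] r(2) by simp
  finally have full1: "form_tensor C B B = B \<cdot> ?m \<cdot> ((\<i>\<d> ?V \<^bold>+ \<c> U U) \<otimes>\<^sub>a \<i>\<d> ?V)" .
  have "form_tensor C B B = form_tensor C B Q \<cdot> (\<i>\<d> ?V \<otimes>\<^sub>a ?\<rho>)"
    using form_tensor_Comp[OF Bh Q idV r(1)] Ident_right[OF Bh] by (simp flip: B)
  also have "\<dots> = B \<cdot> ?m \<cdot> (\<i>\<d> ?V \<otimes>\<^sub>a \<iota>) \<cdot> (\<i>\<d> ?V \<otimes>\<^sub>a ?\<rho>)"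
    using Comp_assoc[OF V\<rho> Comp_in_hom[OF V\<iota> m] Bh] Comp_assoc[OF V\<rho> V\<iota> m] by (simp add: left)
  also have "(\<i>\<d> ?V \<otimes>\<^sub>a \<iota>) \<cdot> (\<i>\<d> ?V \<otimes>\<^sub>a ?\<rho>) = \<i>\<d> ?V \<otimes>\<^sub>a (\<i>\<d> ?V \<^bold>+ \<c> U U)"
    using TensA_Comp[OF idV idV r(1) G(3)] Ident_right[OF idV] r(2) by simp
  finally have full2: "form_tensor C B B = B \<cdot> ?m \<cdot> (\<i>\<d> ?V \<otimes>\<^sub>a (\<i>\<d> ?V \<^bold>+ \<c> U U))" .
  from right left full1 full2 show ?thesis by blast
qed

end
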